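(* For any integer $k\ge0$, the sequence $(S(n,k))_{n\ge0}$ of Stirling numbers of the second kind is log-concave, i.e. $S(n,k)^2\ge S(n-1,k)\,S(n+1,k)$ for all $n\ge1$.
   Context: $S(n,k)$ is the number of set partitions of $[n]=\{1,\ldots,n\}$ into exactly $k$ (nonempty, unordered) blocks. *)

theory Defs
  imports Main "HOL-Library.Disjoint_Sets"
begin

(* The combinatorial definition, rather than the recursively defined function Stirling of
   HOL-Combinatorics. The set counted is finite (a subset of Pow (Pow {1..n})), and all P in it
   are finite, so neither use of card falls back to the value 0 for infinite sets. *)
definition stirling2 :: "nat \<Rightarrow> nat \<Rightarrow> nat" where
  "stirling2 n k = card {P. partition_on {1..n} P \<and> card P = k}"

end

theory Submission
  imports Defs
begin

text \<open>
  Adding one point to the ground set gives the triangular recurrence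
  \<open>S(n + 1, k + 1) = (k + 1) S(n, k + 1) + S(n, k)\<close>: the new point is a block on its own, or it
  joins one of the existing blocks. For fixed \<open>k\<close> this is a first-order linear recurrence in
  \<open>n\<close> that produces column \<open>k + 1\<close> from column \<open>k\<close>; in other words, column \<open>k + 1\<close> is (up to a
  shift) the convolution of column \<open>k\<close> with the geometric sequence of ratio \<open>k + 1\<close>.
  Such a convolution preserves log-concavity as long as the sequence has no internal zeros, and
  column \<open>0\<close> is \<open>1, 0, 0, \<dots>\<close>, so the theorem follows by induction on \<open>k\<close>.

  The columns begin with zeros, so cancelling terms or comparing ratios would force case
  distinctions. The induction therefore carries the inequality
  \<open>a i * a (j + 1) \<le> a (i + 1) * a j\<close> for all \<open>i \<le> j\<close>. It says that the quotients
  \<open>a (i + 1) / a i\<close> decrease weakly where they are defined, but in product form, and it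
  excludes internal zeros; its instance \<open>j = i + 1\<close> is log-concavity. The inductive step is
  \<open>strongly_log_concave_linear_recurrence\<close>, and the recurrence is \<open>stirling2_Suc_Suc\<close>.
\<close>

section \<open>Strong log-concavity under linear recurrences\<close>

definition strongly_log_concave :: "(nat \<Rightarrow> 'a::linordered_semidom) \<Rightarrow> bool" where
  "strongly_log_concave a \<longleftrightarrow> (\<forall>i j. i \<le> j \<longrightarrow> a i * a (Suc j) \<le> a (Suc i) * a j)"

text \<open>
  Strong log-concavity says that the determinants with rows \<open>a (i + 1), a i\<close> and
  \<open>a (j + 1), a j\<close> are nonnegative for \<open>i \<le> j\<close>. The step from \<open>a\<close> to \<open>b\<close> goes through the mixed
  determinants, with first row \<open>b (i + 1), b i\<close> and second row \<open>a (j + 1), a j\<close>. Expanding one row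
  of \<open>b\<close> by its recurrence turns a determinant in \<open>b\<close> alone into \<open>m\<close> times an earlier one plus a
  mixed one, and a mixed one into \<open>m\<close> times an earlier mixed one plus one in \<open>a\<close> alone. As
  \<open>m \<ge> 0\<close>, nonnegativity passes along both expansions.
\<close>

lemma strongly_log_concave_linear_recurrence:
  fixes a b :: "nat \<Rightarrow> 'a::linordered_semidom"
  assumes a: "strongly_log_concave a"
    and b_0: "b 0 = 0" and b_Suc: "\<And>n. b (Suc n) = m * b n + a n"
    and nonneg: "0 \<le> m" "\<And>n. 0 \<le> a n"
  shows "strongly_log_concave b"
proof -
  have b_nonneg: "0 \<le> b n" for n
    by (induction n) (simp_all add: b_0 b_Suc nonneg)
  have mixed: "b i * a (Suc j) \<le> b (Suc i) * a j" if "i \<le> j" for i j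
    using that
  proof (induction i)
    case 0
    then show ?case
      by (simp add: b_0 b_nonneg nonneg)
  next
    case (Suc i)
    have "b (Suc i) * a (Suc j) = m * (b i * a (Suc j)) + a i * a (Suc j)"
      by (simp add: b_Suc algebra_simps)
    also have "\<dots> \<le> m * (b (Suc i) * a j) + a (Suc i) * a j"
      using Suc a nonneg by (intro add_mono mult_left_mono) (auto simp: strongly_log_concave_def)
    also have "\<dots> = b (Suc (Suc i)) * a j"
      by (simp add: b_Suc[of "Suc i"] algebra_simps)
    finally show ?case .
  qed
  have "b i * b (Suc j) \<le> b (Suc i) * b j" if "i \<le> j" for i j
    using that
  proof (induction j rule: dec_induct)
    case base
    show ?case
      by (simp add: mult.commute)
  next
    case (step j)
    have "b i * b (Suc (Suc j)) = m * (b i * b (Suc j)) + b i * a (Suc j)"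
      by (simp add: b_Suc[of "Suc j"] algebra_simps)
    also have "\<dots> \<le> m * (b (Suc i) * b j) + b (Suc i) * a j"
      using step mixed nonneg by (intro add_mono mult_left_mono) auto
    also have "\<dots> = b (Suc i) * b (Suc j)"
      by (simp add: b_Suc[of j] algebra_simps)
    finally show ?case .
  qed
  then show ?thesis
    by (simp add: strongly_log_concave_def)
qed

section \<open>Partitions of a set with one more point\<close>

lemma card_partitions_singleton_block:
  assumes "finite A" "x \<notin> A"
  shows "card {P. partition_on (insert x A) P \<and> card P = Suc k \<and> {x} \<in> P} =
         card {Q. partition_on A Q \<and> card Q = k}"
proof -
  have "bij_betw (insert {x}) {Q. partition_on A Q \<and> card Q = k}
          {P. partition_on (insert x A) P \<and> card P = Suc k \<and> {x} \<in> P}"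
  proof (rule bij_betw_byWitness[where f' = "\<lambda>P. P - {{x}}"])
    have notin: "{x} \<notin> Q" if "partition_on A Q" for Q
      using that \<open>x \<notin> A\<close> by (auto simp: partition_on_def)
    then show "\<forall>Q\<in>{Q. partition_on A Q \<and> card Q = k}. insert {x} Q - {{x}} = Q"
      by auto
    show "\<forall>P\<in>{P. partition_on (insert x A) P \<and> card P = Suc k \<and> {x} \<in> P}.
            insert {x} (P - {{x}}) = P"
      by auto
    show "insert {x} ` {Q. partition_on A Q \<and> card Q = k}
            \<subseteq> {P. partition_on (insert x A) P \<and> card P = Suc k \<and> {x} \<in> P}"
    proof safe
      fix Q assume Q: "partition_on A Q"
      show "partition_on (insert x A) (insert {x} Q)"
        using Q \<open>x \<notin> A\<close> partition_onD1[OF Q] by (subst partition_on_insert) (auto simp: disjnt_def)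
      show "card (insert {x} Q) = Suc (card Q)"
        using finite_elements[OF \<open>finite A\<close> Q] notin[OF Q] by simp
    qed
    show "(\<lambda>P. P - {{x}}) ` {P. partition_on (insert x A) P \<and> card P = Suc k \<and> {x} \<in> P}
            \<subseteq> {Q. partition_on A Q \<and> card Q = k}"
    proof safe
      fix P assume P: "partition_on (insert x A) P" "{x} \<in> P" "card P = Suc k"
      have "disjnt {x} (\<Union>(P - {{x}}))"
        using P(1,2) by (fastforce simp: partition_on_def disjoint_def disjnt_def)
      moreover have "partition_on (insert x A) (insert {x} (P - {{x}}))"
        using P by (simp add: insert_absorb)
      ultimately have "partition_on (insert x A - {x}) (P - {{x}})"
        by (simp only: partition_on_insert)
      then show "partition_on A (P - {{x}})"
        using \<open>x \<notin> A\<close> by simp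
      show "card (P - {{x}}) = k"
        using P by simp
    qed
  qed
  then show ?thesis
    by (simp add: bij_betw_same_card)
qed

text \<open>
  A partition in which \<open>x\<close> shares its block is determined by the partition left after deleting \<open>x\<close>
  together with the block that lost \<open>x\<close>, and that block can be any of the \<open>k\<close> blocks left.
\<close>

lemma card_partitions_no_singleton_block:
  assumes "finite A" "x \<notin> A"
  shows "card {P. partition_on (insert x A) P \<and> card P = k \<and> {x} \<notin> P} =
         k * card {Q. partition_on A Q \<and> card Q = k}"
proof -
  define \<Q> where "\<Q> = {Q. partition_on A Q \<and> card Q = k}"
  define \<P> where "\<P> = {P. partition_on (insert x A) P \<and> card P = k \<and> {x} \<notin> P}"
  define join where "join = (\<lambda>(Q, B). insert (insert x B) (Q - {B}))"
  have x_notin: "x \<notin> B" if "Q \<in> \<Q>" "B \<in> Q" for Q B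
    using that \<open>x \<notin> A\<close> by (auto simp: \<Q>_def partition_on_def)
  have "bij_betw join (Sigma \<Q> (\<lambda>Q. Q)) \<P>"
    unfolding bij_betw_def
  proof
    show "inj_on join (Sigma \<Q> (\<lambda>Q. Q))"
    proof (rule inj_onI, clarify)
      fix Q B R C
      assume Q: "Q \<in> \<Q>" "B \<in> Q" and R: "R \<in> \<Q>" "C \<in> R" and eq: "join (Q, B) = join (R, C)"
      \<comment> \<open>Both \<open>insert x B\<close> and \<open>insert x C\<close> are the unique block of the joined partition
        that contains \<open>x\<close>.\<close>
      have "insert x B \<in> insert (insert x C) (R - {C})"
        using eq by (auto simp: join_def)
      then have "insert x B = insert x C"
        using x_notin[OF R(1)] by blast
      then have "B = C"
        using x_notin[OF Q] x_notin[OF R] by (simp add: insert_ident)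
      moreover have "insert x B \<notin> Q" "insert x B \<notin> R"
        using x_notin[OF Q(1)] x_notin[OF R(1)] by blast+
      ultimately have "Q - {C} = R - {C}"
        using eq by (simp add: join_def insert_ident)
      with \<open>B = C\<close> Q(2) R(2) show "Q = R \<and> B = C"
        by (metis insert_Diff)
    qed
    show "join ` Sigma \<Q> (\<lambda>Q. Q) = \<P>"
    proof
      show "join ` Sigma \<Q> (\<lambda>Q. Q) \<subseteq> \<P>"
      proof clarify
        fix Q B assume Q: "Q \<in> \<Q>" "B \<in> Q"
        then have part: "partition_on A Q" and "card Q = k"
          by (simp_all add: \<Q>_def)
        have "finite Q"
          using finite_elements[OF \<open>finite A\<close> part] .
        have new: "insert x B \<notin> Q"
          using x_notin[OF Q(1)] by blast
        have disj: "disjnt B (\<Union>(Q - {B}))"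
          using part Q(2) by (fastforce simp: partition_on_def disjoint_def disjnt_def)
        have "partition_on A (insert B (Q - {B}))"
          using part Q(2) by (simp add: insert_absorb)
        then have rest: "partition_on (A - B) (Q - {B})" and "B \<subseteq> A" "B \<noteq> {}"
          unfolding partition_on_insert[OF disj] by blast+
        have "partition_on (insert x A) (insert (insert x B) (Q - {B}))"
        proof (subst partition_on_insert)
          show "disjnt (insert x B) (\<Union>(Q - {B}))"
            using disj x_notin[OF Q(1)] by (auto simp: disjnt_def)
          have "insert x A - insert x B = A - B"
            using \<open>x \<notin> A\<close> by blast
          then show "partition_on (insert x A - insert x B) (Q - {B}) \<and>
              insert x B \<subseteq> insert x A \<and> insert x B \<noteq> {}"
            using rest \<open>B \<subseteq> A\<close> by auto
        qed
        moreover have "card (insert (insert x B) (Q - {B})) = k"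
          using new \<open>finite Q\<close> Q(2) \<open>card Q = k\<close> by (simp add: card_Suc_Diff1 del: card_Diff_insert)
        moreover have "{x} \<notin> insert (insert x B) (Q - {B})"
          using x_notin[OF Q] x_notin[OF Q(1)] \<open>B \<noteq> {}\<close> by blast
        ultimately show "join (Q, B) \<in> \<P>"
          by (simp add: join_def \<P>_def)
      qed
      show "\<P> \<subseteq> join ` Sigma \<Q> (\<lambda>Q. Q)"
      proof
        fix P assume "P \<in> \<P>"
        then have part: "partition_on (insert x A) P" and "card P = k" "{x} \<notin> P"
          by (simp_all add: \<P>_def)
        have "finite P"
          using finite_elements[OF _ part] \<open>finite A\<close> by simp
        have "x \<in> \<Union>P"
          using part by (simp add: partition_on_def)
        then obtain C where C: "C \<in> P" "x \<in> C"
          by blast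
        define B where "B = C - {x}"
        have C_eq: "C = insert x B" and "x \<notin> B"
          using C(2) by (auto simp: B_def)
        have "B \<noteq> {}"
          using C(1) \<open>{x} \<notin> P\<close> C_eq by blast
        have disj: "disjnt C (\<Union>(P - {C}))"
          using part C(1) by (fastforce simp: partition_on_def disjoint_def disjnt_def)
        have "partition_on (insert x A) (insert C (P - {C}))"
          using part C(1) by (simp add: insert_absorb)
        then have "partition_on (insert x A - C) (P - {C})" and "C \<subseteq> insert x A"
          unfolding partition_on_insert[OF disj] by blast+
        moreover have "insert x A - C = A - B"
          using \<open>x \<notin> A\<close> by (auto simp: C_eq)
        ultimately have rest: "partition_on (A - B) (P - {C})" and "B \<subseteq> A"
          using \<open>x \<notin> B\<close> by (auto simp: C_eq)
        have "B \<notin> P - {C}"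
          using rest \<open>B \<noteq> {}\<close> by (auto simp: partition_on_def)
        have "partition_on A (insert B (P - {C}))"
          using rest \<open>B \<subseteq> A\<close> \<open>B \<noteq> {}\<close> disj
          by (subst partition_on_insert) (auto simp: C_eq disjnt_def)
        moreover have "card (insert B (P - {C})) = k"
          using \<open>finite P\<close> \<open>B \<notin> P - {C}\<close> C(1) \<open>card P = k\<close> by (simp add: card_Suc_Diff1 del: card_Diff_insert)
        moreover have "join (insert B (P - {C}), B) = P"
          using \<open>B \<notin> P - {C}\<close> C(1) by (auto simp: join_def C_eq)
        ultimately show "P \<in> join ` Sigma \<Q> (\<lambda>Q. Q)"
          unfolding \<Q>_def by (intro image_eqI[of _ _ "(insert B (P - {C}), B)"]) auto
      qed
    qed
  qed
  then have "card \<P> = card (Sigma \<Q> (\<lambda>Q. Q))"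
    by (simp add: bij_betw_same_card)
  also have "\<dots> = (\<Sum>Q\<in>\<Q>. card Q)"
  proof (rule card_SigmaI)
    show "finite \<Q>"
      using finitely_many_partition_on[OF \<open>finite A\<close>] by (simp add: \<Q>_def)
    show "\<forall>Q\<in>\<Q>. finite Q"
      using finite_elements[OF \<open>finite A\<close>] by (simp add: \<Q>_def)
  qed
  also have "\<dots> = k * card \<Q>"
    by (simp add: \<Q>_def)
  finally show ?thesis
    by (simp add: \<P>_def \<Q>_def)
qed

section \<open>The columns of the Stirling triangle\<close>

lemma stirling2_Suc_Suc:
  "stirling2 (Suc n) (Suc k) = Suc k * stirling2 n (Suc k) + stirling2 n k"
proof -
  let ?A = "{1..n}" and ?x = "Suc n"
  let ?U = "{P. partition_on (insert ?x ?A) P \<and> card P = Suc k \<and> {?x} \<notin> P}"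
  let ?V = "{P. partition_on (insert ?x ?A) P \<and> card P = Suc k \<and> {?x} \<in> P}"
  have fin: "finite {P. partition_on (insert ?x ?A) P}"
    by (rule finitely_many_partition_on) simp
  have "{1..Suc n} = insert ?x ?A"
    by auto
  then have "stirling2 (Suc n) (Suc k) =
      card {P. partition_on (insert ?x ?A) P \<and> card P = Suc k}"
    by (simp only: stirling2_def)
  also have "{P. partition_on (insert ?x ?A) P \<and> card P = Suc k} = ?U \<union> ?V"
    by auto
  also have "card (?U \<union> ?V) = card ?U + card ?V"
    by (rule card_Un_disjoint) (auto intro: finite_subset[OF _ fin])
  also have "\<dots> = Suc k * stirling2 n (Suc k) + stirling2 n k"
    by (simp only: stirling2_def card_partitions_singleton_block card_partitions_no_singleton_block
        finite_atLeastAtMost atLeastAtMost_iff Suc_n_not_le_n simp_thms)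
  finally show ?thesis .
qed

lemma stirling2_0_Suc: "stirling2 0 (Suc k) = 0"
proof -
  have "{P :: nat set set. P = {} \<and> card P = Suc k} = {}"
    by auto
  then show ?thesis
    by (simp add: stirling2_def partition_on_empty)
qed

lemma stirling2_Suc_0: "stirling2 (Suc n) 0 = 0"
proof -
  have "card P \<noteq> 0" if P: "partition_on {1..Suc n} P" for P
  proof -
    have "finite P"
      using finite_elements[OF _ P] by simp
    moreover have "P \<noteq> {}"
      using partition_onD1[OF P] by auto
    ultimately show ?thesis
      by simp
  qed
  then have "{P. partition_on {1..Suc n} P \<and> card P = 0} = {}"
    by blast
  then show ?thesis
    by (simp only: stirling2_def card.empty)
qed

lemma strongly_log_concave_stirling2: "strongly_log_concave (\<lambda>n. stirling2 n k)"
proof (induction k)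
  case 0
  show ?case
    by (simp add: strongly_log_concave_def stirling2_Suc_0)
next
  case (Suc k)
  show ?case
    by (rule strongly_log_concave_linear_recurrence[OF Suc, where m = "Suc k"])
      (simp_all only: stirling2_0_Suc stirling2_Suc_Suc of_nat_id le0)
qed

theorem theorem7p2:
  fixes k :: nat
  shows "\<forall>n\<ge>1. (stirling2 n k)\<^sup>2 \<ge> stirling2 (n - 1) k * stirling2 (n + 1) k"
proof (intro allI impI)
  fix n :: nat
  assume "1 \<le> n"
  then show "stirling2 (n - 1) k * stirling2 (n + 1) k \<le> (stirling2 n k)\<^sup>2"
    using strongly_log_concave_stirling2[of k, unfolded strongly_log_concave_def, rule_format,
        of "n - 1" n]
    by (simp add: power2_eq_square)
qed

end
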